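(* Let $f:\mathbb{R}\to\mathbb{R}$ be an absolutely continuous function such that $f$ and $f'$ are in $L^1(\mathbb{R})$. Then for each $x\in\mathbb{R}$, $$ f(x)=\frac{1}{2\pi}\lim_{R\to\infty}\int_{-R}^{R} e^{ixs}\int_{-\infty}^{\infty} e^{-ist}f(t)\,dt\,ds. $$
   Context: Integrals are Lebesgue integrals. Absolute continuity on $\mathbb{R}$ is understood as a local condition: $f$ is absolutely continuous on every compact interval (so $f'$ exists almost everywhere, is integrable on compact intervals, and $\int_a^b f'(t)\,dt=f(b)-f(a)$). *)

theory Defs
  imports "HOL-Analysis.Analysis"
begin

(* HOL-Analysis uses the name absolutely_continuous for pairs of measures; the notions
   below are the ones for functions. *)

definition absolutely_continuous_on :: "real set \<Rightarrow> (real \<Rightarrow> real) \<Rightarrow> bool" where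
  "absolutely_continuous_on S f \<longleftrightarrow>
     (\<forall>\<epsilon>>0. \<exists>\<delta>>0. \<forall>(n::nat) (a::nat \<Rightarrow> real) (b::nat \<Rightarrow> real).
        (\<forall>i<n. a i < b i \<and> {a i..b i} \<subseteq> S) \<longrightarrow>
        disjoint_family_on (\<lambda>i. {a i<..<b i}) {..<n} \<longrightarrow>
        (\<Sum>i<n. b i - a i) < \<delta> \<longrightarrow>
        (\<Sum>i<n. \<bar>f (b i) - f (a i)\<bar>) < \<epsilon>)"

definition locally_absolutely_continuous :: "(real \<Rightarrow> real) \<Rightarrow> bool" where
  "locally_absolutely_continuous f \<longleftrightarrow> (\<forall>u v. absolutely_continuous_on {u..v} f)"

end

theory Submission
  imports Defs "HOL-Probability.Sinc_Integral"
begin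

text \<open>
  By Fubini's theorem the truncated inversion integral equals
  \<open>1 / pi\<close> times the integral over the real line of \<open>f (x + u) * sin (R u) / u\<close>
  (\<open>truncated_Fourier_inversion_eq_Dirichlet_integral\<close>). The kernel is even, so it remains to show
  that for each of the two functions \<open>g u = f (x + u)\<close> and \<open>g u = f (x - u)\<close> the integral of
  \<open>g u * sin (R u) / u\<close> over the half-line \<open>u \<ge> 0\<close> tends to \<open>pi / 2 * g 0\<close>
  (\<open>dirichlet_kernel_half_line_tendsto\<close>).

  This is Dirichlet's classical theorem for functions of bounded variation. Absolute continuity
  enters in the form that the variation of \<open>g\<close> over an interval is small when the interval is short.
  The tool is the inequality \<open>integral_by_parts_variation_bound\<close>, an integration by parts in which
  \<open>g\<close> enters through its variation and the kernel through its primitive \<open>Si (R u)\<close>, the sine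
  integral. The half-line splits into three parts:

  \<^item> On a short interval \<open>[0, a]\<close> the primitive is bounded uniformly in \<open>R\<close> and the variation of
    \<open>g\<close> is small. So the integral is nearly the boundary term \<open>g a * Si (R a)\<close>, whose
    limit is \<open>g a * pi / 2\<close>.

  \<^item> On \<open>[a, M]\<close> the primitive \<open>Si (R u) - pi / 2\<close> tends to \<open>0\<close> uniformly, hence so does the integral.

  \<^item> Beyond \<open>M\<close> the kernel is at most \<open>1 / M\<close> in absolute value, and \<open>g\<close> is integrable.
\<close>

section \<open>Integration by parts against a function of small variation\<close>

definition equipartition_variation :: "(real \<Rightarrow> real) \<Rightarrow> real \<Rightarrow> real \<Rightarrow> nat \<Rightarrow> real" where
  "equipartition_variation g a b n =
     (\<Sum>i<n. \<bar>g (a + real (Suc i) * ((b - a) / real n)) - g (a + real i * ((b - a) / real n))\<bar>)"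

lemma equipartition_variation_1: "equipartition_variation g a b 1 = \<bar>g b - g a\<bar>"
  by (simp add: equipartition_variation_def)

text \<open>
  Writing \<open>\<omega>\<close> for the oscillation of \<open>g\<close> on a short interval, \<open>g\<close> may be frozen at the left
  endpoint at cost \<open>\<omega> B (d - c)\<close>; what remains is one term of Abel's summation formula.
\<close>

lemma integral_by_parts_cell:
  fixes g k K :: "real \<Rightarrow> real"
  assumes "c \<le> d" and g: "continuous_on {c..d} g" and k: "continuous_on {c..d} k"
    and K: "\<And>u. u \<in> {c..d} \<Longrightarrow> (K has_real_derivative k u) (at u)"
    and C: "\<bar>K d\<bar> \<le> C"
    and B: "\<And>u. u \<in> {c..d} \<Longrightarrow> \<bar>k u\<bar> \<le> B"
    and \<omega>: "\<And>u. u \<in> {c..d} \<Longrightarrow> \<bar>g u - g c\<bar> \<le> \<omega>"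
  shows "\<bar>integral {c..d} (\<lambda>u. g u * k u) - (g d * K d - g c * K c)\<bar> \<le> C * \<bar>g d - g c\<bar> + \<omega> * B * (d - c)"
proof -
  have "(k has_integral (K d - K c)) {c..d}"
    using K by (intro fundamental_theorem_of_calculus[OF \<open>c \<le> d\<close>])
      (auto simp: has_real_derivative_iff_has_vector_derivative intro: has_vector_derivative_at_within)
  then have 1: "((\<lambda>u. g c * k u) has_integral (g c * (K d - K c))) {c..d}"
    by (rule has_integral_mult_right)
  have 2: "(\<lambda>u. (g u - g c) * k u) integrable_on {c..d}"
    by (intro integrable_continuous_real continuous_intros g k)
  have "integral {c..d} (\<lambda>u. g u * k u) = integral {c..d} (\<lambda>u. (g u - g c) * k u + g c * k u)"
    by (simp add: algebra_simps)
  also have "\<dots> = integral {c..d} (\<lambda>u. (g u - g c) * k u) + g c * (K d - K c)"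
    using 1 2 by (subst Henstock_Kurzweil_Integration.integral_add) (auto simp: has_integral_iff)
  finally have eq: "integral {c..d} (\<lambda>u. g u * k u) - (g d * K d - g c * K c)
      = integral {c..d} (\<lambda>u. (g u - g c) * k u) - (g d - g c) * K d"
    by (simp add: algebra_simps)
  have "\<omega> \<ge> 0" using \<omega>[of c] \<open>c \<le> d\<close> by auto
  then have "\<bar>integral {c..d} (\<lambda>u. (g u - g c) * k u)\<bar> \<le> \<omega> * B * (d - c)"
    unfolding real_norm_def[symmetric]
    using \<omega> B by (intro integral_bound[OF \<open>c \<le> d\<close>] continuous_intros g k)
      (auto simp: abs_mult intro!: mult_mono)
  moreover have "\<bar>(g d - g c) * K d\<bar> \<le> C * \<bar>g d - g c\<bar>"
    using C by (simp add: abs_mult mult.commute mult_right_mono)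
  ultimately show ?thesis unfolding eq by linarith
qed

text \<open>
  This is the estimate of the Riemann--Stieltjes integral of \<open>K\<close> with respect to \<open>g\<close>, which equals
  the difference on the left up to sign, by \<open>sup \<bar>K\<bar>\<close> times the variation of \<open>g\<close>. Abel summation
  over equal subintervals gives it directly, with an error that vanishes with the mesh because \<open>g\<close>
  is uniformly continuous. The bound involves the primitive \<open>K\<close> and not \<open>k\<close> itself: this is what
  makes it useful for an oscillating \<open>k\<close>.
\<close>

lemma integral_by_parts_variation_bound:
  fixes g k K :: "real \<Rightarrow> real"
  assumes ab: "a < b" and g: "continuous_on {a..b} g" and k: "continuous_on {a..b} k"
    and K: "\<And>u. u \<in> {a..b} \<Longrightarrow> (K has_real_derivative k u) (at u)"
    and C: "\<And>u. u \<in> {a..b} \<Longrightarrow> \<bar>K u\<bar> \<le> C"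
    and V: "\<And>n. n > 0 \<Longrightarrow>
      equipartition_variation g a b n \<le> V"
  shows "\<bar>integral {a..b} (\<lambda>u. g u * k u) - (g b * K b - g a * K a)\<bar> \<le> C * V"
proof (rule field_le_epsilon)
  fix e :: real assume "e > 0"
  have "C \<ge> 0" using C[of a] ab by auto
  have "bounded (k ` {a..b})"
    by (intro compact_imp_bounded compact_continuous_image k compact_Icc)
  then obtain B where "B > 0" and B: "\<And>u. u \<in> {a..b} \<Longrightarrow> \<bar>k u\<bar> \<le> B"
    unfolding bounded_pos by auto
  \<comment> \<open>chosen so that the errors of all subintervals, \<open>\<omega> B\<close> times their length, add up to \<open>e\<close>\<close>
  define \<omega> where "\<omega> = e / (B * (b - a))"
  have "\<omega> > 0" using \<open>e > 0\<close> \<open>B > 0\<close> ab by (simp add: \<omega>_def)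
  obtain d where "d > 0" and d: "\<And>u v. u \<in> {a..b} \<Longrightarrow> v \<in> {a..b} \<Longrightarrow> \<bar>u - v\<bar> < d \<Longrightarrow> \<bar>g u - g v\<bar> < \<omega>"
    using compact_uniformly_continuous[OF g compact_Icc] \<open>\<omega> > 0\<close>
    unfolding uniformly_continuous_on_def dist_real_def by metis
  obtain n :: nat where "n > 0" and n: "inverse (real n) < d / (b - a)"
    using ex_inverse_of_nat_less[of "d / (b - a)"] \<open>d > 0\<close> ab by auto
  define h where "h = (b - a) / real n"
  have h: "0 < h" "h < d" "real n * h = b - a"
    using n ab \<open>n > 0\<close> by (auto simp: h_def field_simps)
  define p where "p i = a + real i * h" for i :: nat
  have p_Suc: "p (Suc i) = p i + h" for i by (simp add: p_def algebra_simps)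
  have p_in: "a \<le> p i" "i \<le> n \<Longrightarrow> p i \<le> b" for i
    using h mult_right_mono[of "real i" "real n" h] by (auto simp: p_def)
  have step: "\<bar>integral {a..p m} (\<lambda>u. g u * k u) - (g (p m) * K (p m) - g a * K a)\<bar>
      \<le> C * (\<Sum>i<m. \<bar>g (p (Suc i)) - g (p i)\<bar>) + \<omega> * B * (p m - a)" if "m \<le> n" for m
    using that
  proof (induction m)
    case 0
    then show ?case by (simp add: p_def)
  next
    case (Suc m)
    have le: "a \<le> p m" "p m \<le> p (Suc m)" "p (Suc m) \<le> b"
      using p_in(1)[of m] p_in(2)[OF Suc.prems] h by (auto simp: p_Suc)
    have "\<bar>integral {p m..p (Suc m)} (\<lambda>u. g u * k u) - (g (p (Suc m)) * K (p (Suc m)) - g (p m) * K (p m))\<bar>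
      \<le> C * \<bar>g (p (Suc m)) - g (p m)\<bar> + \<omega> * B * (p (Suc m) - p m)"
    proof (rule integral_by_parts_cell)
      show "\<bar>g u - g (p m)\<bar> \<le> \<omega>" if "u \<in> {p m..p (Suc m)}" for u
        using d[of u "p m"] that le h by (auto simp: p_Suc)
    qed (use le K C B in \<open>auto intro: continuous_on_subset[OF g] continuous_on_subset[OF k]\<close>)
    moreover have "integral {a..p (Suc m)} (\<lambda>u. g u * k u)
        = integral {a..p m} (\<lambda>u. g u * k u) + integral {p m..p (Suc m)} (\<lambda>u. g u * k u)"
      using le by (intro Henstock_Kurzweil_Integration.integral_combine[symmetric] integrable_continuous_real
          continuous_on_mult continuous_on_subset[OF g] continuous_on_subset[OF k]) auto
    ultimately show ?case using Suc by (simp add: algebra_simps)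
  qed
  have "p n = b" using h by (simp add: p_def)
  then have "\<bar>integral {a..b} (\<lambda>u. g u * k u) - (g b * K b - g a * K a)\<bar>
      \<le> C * (\<Sum>i<n. \<bar>g (p (Suc i)) - g (p i)\<bar>) + \<omega> * B * (b - a)"
    using step[of n] by simp
  also have "\<dots> \<le> C * V + e"
    using V[OF \<open>n > 0\<close>] \<open>C \<ge> 0\<close> \<open>B > 0\<close> ab
    by (intro add_mono mult_left_mono) (auto simp: \<omega>_def p_def h_def equipartition_variation_def)
  finally show "\<bar>integral {a..b} (\<lambda>u. g u * k u) - (g b * K b - g a * K a)\<bar> \<le> C * V + e" .
qed

section \<open>Locally absolutely continuous functions\<close>

text \<open>
  The subintervals of an equipartition of \<open>[a, b]\<close> are disjoint with total length \<open>b - a\<close>, so they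
  are an admissible family as soon as \<open>b - a\<close> is below the \<open>\<delta>\<close> of absolute continuity, however many
  they are.
\<close>

lemma absolutely_continuous_on_small_variation:
  assumes "absolutely_continuous_on {u..v} g" and "\<epsilon> > 0"
  shows "\<exists>\<delta>>0. \<forall>a b n. u \<le> a \<longrightarrow> a < b \<longrightarrow> b \<le> v \<longrightarrow> b - a < \<delta> \<longrightarrow> n > 0 \<longrightarrow>
      equipartition_variation g a b n < \<epsilon>"
proof -
  obtain \<delta> where "\<delta> > 0" and \<delta>: "\<And>(n::nat) (a::nat \<Rightarrow> real) (b::nat \<Rightarrow> real).
        (\<forall>i<n. a i < b i \<and> {a i..b i} \<subseteq> {u..v}) \<Longrightarrow>
        disjoint_family_on (\<lambda>i. {a i<..<b i}) {..<n} \<Longrightarrow>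
        (\<Sum>i<n. b i - a i) < \<delta> \<Longrightarrow> (\<Sum>i<n. \<bar>g (b i) - g (a i)\<bar>) < \<epsilon>"
    using assms unfolding absolutely_continuous_on_def by meson
  have "equipartition_variation g a b n < \<epsilon>"
    if ab: "u \<le> a" "a < b" "b \<le> v" "b - a < \<delta>" "n > 0" for a b n
  proof -
    define h where "h = (b - a) / real n"
    have h: "h > 0" "real n * h = b - a" using ab by (auto simp: h_def)
    define p where "p i = a + real i * h" for i :: nat
    have mono: "p i \<le> p j" if "i \<le> j" for i j
      using that h by (simp add: p_def)
    have pn: "p 0 = a" "p n = b" using h by (auto simp: p_def)
    have "(\<Sum>i<n. \<bar>g (p (Suc i)) - g (p i)\<bar>) < \<epsilon>"
    proof (rule \<delta>)
      show "\<forall>i<n. p i < p (Suc i) \<and> {p i..p (Suc i)} \<subseteq> {u..v}"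
      proof (intro allI impI)
        fix i assume "i < n"
        then have "p 0 \<le> p i" "p (Suc i) \<le> p n" by (auto intro!: mono)
        moreover have "p i < p (Suc i)" using h by (simp add: p_def)
        ultimately show "p i < p (Suc i) \<and> {p i..p (Suc i)} \<subseteq> {u..v}"
          using ab pn by auto
      qed
      have "{p i<..<p (Suc i)} \<inter> {p j<..<p (Suc j)} = {}" if "i < j" for i j
        using mono[of "Suc i" j] that by auto
      then show "disjoint_family_on (\<lambda>i. {p i<..<p (Suc i)}) {..<n}"
        unfolding disjoint_family_on_def by (metis inf_commute linorder_neqE_nat)
      show "(\<Sum>i<n. p (Suc i) - p i) < \<delta>"
        using ab pn by (simp add: sum_lessThan_telescope)
    qed
    then show ?thesis by (simp add: p_def h_def equipartition_variation_def)
  qed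
  with \<open>\<delta> > 0\<close> show ?thesis by blast
qed

lemma locally_absolutely_continuous_imp_continuous:
  assumes "locally_absolutely_continuous g"
  shows "continuous_on UNIV g"
  unfolding continuous_on_iff dist_real_def
proof (intro ballI allI impI)
  fix x e :: real assume "e > 0"
  have "absolutely_continuous_on {x-1..x+1} g"
    using assms by (simp add: locally_absolutely_continuous_def)
  then obtain \<delta> where "\<delta> > 0" and \<delta>: "\<And>a b n. x - 1 \<le> a \<Longrightarrow> a < b \<Longrightarrow> b \<le> x + 1 \<Longrightarrow> b - a < \<delta> \<Longrightarrow> n > 0 \<Longrightarrow>
      equipartition_variation g a b n < e"
    using absolutely_continuous_on_small_variation[OF _ \<open>e > 0\<close>] by blast
  have \<delta>': "\<bar>g b - g a\<bar> < e" if "x - 1 \<le> a" "a < b" "b \<le> x + 1" "b - a < \<delta>" for a b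
    using \<delta>[OF that, of 1] by (simp add: equipartition_variation_1[simplified])
  have "\<bar>g y - g x\<bar> < e" if "\<bar>y - x\<bar> < min \<delta> 1" for y
    using \<delta>'[of x y] \<delta>'[of y x] that \<open>e > 0\<close> by (cases x y rule: linorder_cases) (simp_all add: abs_minus_commute)
  then show "\<exists>d>0. \<forall>x'\<in>UNIV. \<bar>x' - x\<bar> < d \<longrightarrow> \<bar>g x' - g x\<bar> < e"
    using \<open>\<delta> > 0\<close> by (intro exI[of _ "min \<delta> 1"]) auto
qed

text \<open>
  Translations are covered as well: \<open>f (x + u)\<close> arises from two reflections.
\<close>

lemma locally_absolutely_continuous_reflect:
  assumes "locally_absolutely_continuous f"
  shows "locally_absolutely_continuous (\<lambda>u. f (x - u))"
  unfolding locally_absolutely_continuous_def absolutely_continuous_on_def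
proof (intro allI impI)
  fix u v \<epsilon> :: real assume "\<epsilon> > 0"
  have "absolutely_continuous_on {x - v..x - u} f"
    using assms by (simp add: locally_absolutely_continuous_def)
  then obtain \<delta> where "\<delta> > 0" and \<delta>: "\<And>(n::nat) (a::nat \<Rightarrow> real) (b::nat \<Rightarrow> real).
        (\<forall>i<n. a i < b i \<and> {a i..b i} \<subseteq> {x - v..x - u}) \<Longrightarrow>
        disjoint_family_on (\<lambda>i. {a i<..<b i}) {..<n} \<Longrightarrow>
        (\<Sum>i<n. b i - a i) < \<delta> \<Longrightarrow> (\<Sum>i<n. \<bar>f (b i) - f (a i)\<bar>) < \<epsilon>"
    using \<open>\<epsilon> > 0\<close> unfolding absolutely_continuous_on_def by meson
  show "\<exists>\<delta>>0. \<forall>(n::nat) a b. (\<forall>i<n. a i < b i \<and> {a i..b i} \<subseteq> {u..v}) \<longrightarrow>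
     disjoint_family_on (\<lambda>i. {a i<..<b i}) {..<n} \<longrightarrow>
     (\<Sum>i<n. b i - a i) < \<delta> \<longrightarrow> (\<Sum>i<n. \<bar>f (x - b i) - f (x - a i)\<bar>) < \<epsilon>"
  proof (intro exI[of _ \<delta>] conjI allI impI \<open>\<delta> > 0\<close>)
    fix n :: nat and a b :: "nat \<Rightarrow> real"
    assume sub: "\<forall>i<n. a i < b i \<and> {a i..b i} \<subseteq> {u..v}"
      and disj: "disjoint_family_on (\<lambda>i. {a i<..<b i}) {..<n}"
      and len: "(\<Sum>i<n. b i - a i) < \<delta>"
    have "(\<Sum>i<n. \<bar>f (x - a i) - f (x - b i)\<bar>) < \<epsilon>"
    proof (rule \<delta>)
      show "\<forall>i<n. x - b i < x - a i \<and> {x - b i..x - a i} \<subseteq> {x - v..x - u}"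
        using sub by (auto simp: less_imp_le)
      show "disjoint_family_on (\<lambda>i. {x - b i<..<x - a i}) {..<n}"
        unfolding disjoint_family_on_def
      proof (intro ballI impI equals0I)
        fix i j z
        assume ij: "i \<in> {..<n}" "j \<in> {..<n}" "i \<noteq> j"
          and "z \<in> {x - b i<..<x - a i} \<inter> {x - b j<..<x - a j}"
        then have "x - z \<in> {a i<..<b i} \<inter> {a j<..<b j}" by auto
        with disjoint_family_onD[OF disj ij] show False by simp
      qed
      show "(\<Sum>i<n. (x - a i) - (x - b i)) < \<delta>" using len by simp
    qed
    then show "(\<Sum>i<n. \<bar>f (x - b i) - f (x - a i)\<bar>) < \<epsilon>" by (simp add: abs_minus_commute)
  qed
qed

section \<open>The Dirichlet kernel and Dirichlet's integral\<close>

text \<open>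
  This is \<open>sin (R u) / u\<close>, with its continuous value \<open>R\<close> at \<open>u = 0\<close>.
\<close>

definition dirichlet_kernel :: "real \<Rightarrow> real \<Rightarrow> real" where
  "dirichlet_kernel R u = R * sinc (R * u)"

lemma continuous_on_dirichlet_kernel: "continuous_on S (dirichlet_kernel R)"
  unfolding dirichlet_kernel_def [abs_def] by (intro continuous_intros)

lemma borel_measurable_dirichlet_kernel [measurable]: "dirichlet_kernel R \<in> borel_measurable borel"
  by (intro borel_measurable_continuous_onI continuous_on_dirichlet_kernel)

lemma DERIV_Si_scaled: "((\<lambda>u. Si (R * u)) has_real_derivative dirichlet_kernel R u) (at u)"
  using DERIV_chain2[OF DERIV_Si[of "R * u"] DERIV_cmult_Id[of R]]
  by (simp add: dirichlet_kernel_def mult.commute del: mult_eq_0_iff)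

lemma dirichlet_kernel_minus [simp]: "dirichlet_kernel R (- u) = dirichlet_kernel R u"
  by (simp add: dirichlet_kernel_def)

lemma abs_dirichlet_kernel_le: "\<bar>dirichlet_kernel R u\<bar> \<le> \<bar>R\<bar>"
  using abs_sin_x_le_abs_x[of "R * u"] by (auto simp: dirichlet_kernel_def abs_mult divide_simps mult_left_le)

lemma abs_dirichlet_kernel_le_inverse:
  assumes "0 < M" "M \<le> u"
  shows "\<bar>dirichlet_kernel R u\<bar> \<le> 1 / M"
proof (cases "R = 0")
  case False
  have "\<bar>dirichlet_kernel R u\<bar> = \<bar>sin (R * u)\<bar> / u"
    using False assms by (simp add: dirichlet_kernel_def abs_mult)
  also have "\<dots> \<le> 1 / M"
    using assms by (intro frac_le) auto
  finally show ?thesis .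
qed (use assms in \<open>simp add: dirichlet_kernel_def\<close>)

text \<open>
  Away from \<open>0\<close> the primitive \<open>Si (R u) - pi / 2\<close> of the kernel tends to \<open>0\<close> uniformly in \<open>u\<close>,
  because \<open>Si\<close> tends to \<open>pi / 2\<close> at infinity; integration by parts passes this on to the integral.
\<close>

lemma dirichlet_kernel_integral_short_tendsto_0:
  assumes g: "continuous_on {a..b} g" and "0 < a" "a < b"
    and V: "\<And>n. n > 0 \<Longrightarrow>
      equipartition_variation g a b n \<le> V"
  shows "((\<lambda>R. integral {a..b} (\<lambda>u. g u * dirichlet_kernel R u)) \<longlongrightarrow> 0) at_top"
proof (rule tendstoI)
  fix e :: real assume "e > 0"
  define W where "W = \<bar>g a\<bar> + \<bar>g b\<bar> + V + 1"
  have "V \<ge> 0" using V[of 1] by (simp add: equipartition_variation_1[simplified])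
  then have W: "W > 0" by (simp add: W_def)
  define e' where "e' = e / W"
  have e': "e' > 0" "e' * W = e" using W \<open>e > 0\<close> by (auto simp: e'_def)
  obtain T where T: "\<And>t. t \<ge> T \<Longrightarrow> \<bar>Si t - pi / 2\<bar> < e'"
    using tendstoD[OF Si_at_top \<open>e' > 0\<close>] by (auto simp: eventually_at_top_linorder dist_real_def)
  have "dist (integral {a..b} (\<lambda>u. g u * dirichlet_kernel R u)) 0 < e" if R: "R \<ge> max 0 (T / a)" for R
  proof -
    have K: "\<bar>Si (R * u) - pi / 2\<bar> \<le> e'" if "u \<in> {a..b}" for u
    proof -
      have "T \<le> R * a" using R \<open>0 < a\<close> by (simp add: pos_divide_le_eq)
      also have "\<dots> \<le> R * u" using R that by (intro mult_left_mono) auto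
      finally show ?thesis using T by (simp add: less_imp_le)
    qed
    have "\<bar>integral {a..b} (\<lambda>u. g u * dirichlet_kernel R u)
        - (g b * (Si (R * b) - pi / 2) - g a * (Si (R * a) - pi / 2))\<bar> \<le> e' * V"
      by (rule integral_by_parts_variation_bound[OF \<open>a < b\<close> g continuous_on_dirichlet_kernel _ _ V])
         (auto intro!: derivative_eq_intros DERIV_Si_scaled K)
    moreover have "\<bar>g b * (Si (R * b) - pi / 2)\<bar> \<le> e' * \<bar>g b\<bar>" "\<bar>g a * (Si (R * a) - pi / 2)\<bar> \<le> e' * \<bar>g a\<bar>"
      using K[of a] K[of b] \<open>a < b\<close> by (simp_all add: abs_mult mult.commute[of e'] mult_left_mono)
    ultimately have "\<bar>integral {a..b} (\<lambda>u. g u * dirichlet_kernel R u)\<bar> \<le> e' * (\<bar>g a\<bar> + \<bar>g b\<bar> + V)"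
      unfolding distrib_left by linarith
    also have "\<dots> < e' * W" using e'(1) by (simp add: W_def)
    finally show ?thesis using e' by simp
  qed
  then show "\<forall>\<^sub>F R in at_top. dist (integral {a..b} (\<lambda>u. g u * dirichlet_kernel R u)) 0 < e"
    unfolding eventually_at_top_linorder by blast
qed

text \<open>
  A special case of the Riemann--Lebesgue lemma. Absolute continuity bounds the variation on short
  intervals only, so \<open>[a, b]\<close> is cut into finitely many of them.
\<close>

lemma dirichlet_kernel_integral_tendsto_0:
  assumes g: "locally_absolutely_continuous g" and "0 < a" "a < b"
  shows "((\<lambda>R. integral {a..b} (\<lambda>u. g u * dirichlet_kernel R u)) \<longlongrightarrow> 0) at_top"
proof -
  have cont: "continuous_on S g" for S
    using locally_absolutely_continuous_imp_continuous[OF g] continuous_on_subset by blast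
  have "absolutely_continuous_on {a..b} g"
    using g by (simp add: locally_absolutely_continuous_def)
  then obtain \<delta> where "\<delta> > 0" and \<delta>: "\<And>c d n. a \<le> c \<Longrightarrow> c < d \<Longrightarrow> d \<le> b \<Longrightarrow> d - c < \<delta> \<Longrightarrow> n > 0 \<Longrightarrow>
      equipartition_variation g c d n < 1"
    using absolutely_continuous_on_small_variation[OF _ zero_less_one] by blast
  obtain m :: nat where "m > 0" and m: "inverse (real m) < \<delta> / (b - a)"
    using ex_inverse_of_nat_less[of "\<delta> / (b - a)"] \<open>\<delta> > 0\<close> \<open>a < b\<close> by auto
  define h where "h = (b - a) / real m"
  have h: "0 < h" "h < \<delta>" "real m * h = b - a"
    using m \<open>a < b\<close> \<open>m > 0\<close> by (auto simp: h_def field_simps)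
  define p where "p i = a + real i * h" for i :: nat
  have p_Suc: "p (Suc i) = p i + h" for i by (simp add: p_def algebra_simps)
  have p_in: "a \<le> p i" "i \<le> m \<Longrightarrow> p i \<le> b" for i
    using h mult_right_mono[of "real i" "real m" h] by (auto simp: p_def)
  have "((\<lambda>R. integral {a..p k} (\<lambda>u. g u * dirichlet_kernel R u)) \<longlongrightarrow> 0) at_top" if "k \<le> m" for k
    using that
  proof (induction k)
    case 0
    then show ?case by (simp add: p_def)
  next
    case (Suc k)
    have le: "a \<le> p k" "p k < p (Suc k)" "p (Suc k) \<le> b" "p (Suc k) - p k < \<delta>"
      using p_in(1)[of k] p_in(2)[OF Suc.prems] h by (auto simp: p_Suc)
    have "((\<lambda>R. integral {p k..p (Suc k)} (\<lambda>u. g u * dirichlet_kernel R u)) \<longlongrightarrow> 0) at_top"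
      using le \<open>0 < a\<close>
      by (intro dirichlet_kernel_integral_short_tendsto_0[where V = 1] cont less_imp_le[OF \<delta>]) auto
    from tendsto_add[OF Suc.IH this]
    have "((\<lambda>R. integral {a..p k} (\<lambda>u. g u * dirichlet_kernel R u)
        + integral {p k..p (Suc k)} (\<lambda>u. g u * dirichlet_kernel R u)) \<longlongrightarrow> 0) at_top"
      using Suc.prems by simp
    also have "(\<lambda>R. integral {a..p k} (\<lambda>u. g u * dirichlet_kernel R u)
        + integral {p k..p (Suc k)} (\<lambda>u. g u * dirichlet_kernel R u))
        = (\<lambda>R. integral {a..p (Suc k)} (\<lambda>u. g u * dirichlet_kernel R u))"
      using le by (intro ext Henstock_Kurzweil_Integration.integral_combine integrable_continuous_real
          continuous_on_mult cont continuous_on_dirichlet_kernel) auto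
    finally show ?case .
  qed
  from this[of m] show ?thesis using h by (simp add: p_def)
qed

text \<open>
  Near \<open>0\<close> the primitive \<open>Si (R u)\<close> is bounded uniformly in \<open>R\<close>, but not small. Smallness comes from
  \<open>g\<close> instead: over an interval \<open>[0, a]\<close> on which \<open>g\<close> has small variation, the integral is close to the
  boundary term \<open>g a * Si (R a)\<close>, which tends to \<open>g a * pi / 2\<close>, and \<open>g a\<close> is close to \<open>g 0\<close>.
  The rest of the interval contributes nothing in the limit.
\<close>

lemma dirichlet_kernel_integral_tendsto:
  assumes g: "locally_absolutely_continuous g" and "0 < M"
  shows "((\<lambda>R. integral {0..M} (\<lambda>u. g u * dirichlet_kernel R u)) \<longlongrightarrow> pi / 2 * g 0) at_top"
proof (rule tendstoI)
  fix e :: real assume "e > 0"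
  have cont: "continuous_on S g" for S
    using locally_absolutely_continuous_imp_continuous[OF g] continuous_on_subset by blast
  obtain B where B: "\<And>t. \<bar>Si t\<bar> \<le> B" using bounded_Si by blast
  then have "B \<ge> 0" using abs_ge_zero order_trans by blast
  \<comment> \<open>the four errors below are at most \<open>B e'\<close>, \<open>e'\<close>, \<open>e'\<close> and \<open>pi / 2 * e' < 2 e'\<close>\<close>
  define e' where "e' = e / (B + 4)"
  have e': "e' > 0" "e' * (B + 4) = e" using \<open>B \<ge> 0\<close> \<open>e > 0\<close> by (auto simp: e'_def)
  have "absolutely_continuous_on {0..M} g"
    using g by (simp add: locally_absolutely_continuous_def)
  then obtain \<delta> where "\<delta> > 0" and \<delta>: "\<And>c d n. 0 \<le> c \<Longrightarrow> c < d \<Longrightarrow> d \<le> M \<Longrightarrow> d - c < \<delta> \<Longrightarrow> n > 0 \<Longrightarrow>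
      equipartition_variation g c d n < e'"
    using absolutely_continuous_on_small_variation[OF _ \<open>e' > 0\<close>] by blast
  define a where "a = min (\<delta> / 2) (M / 2)"
  have a: "0 < a" "a < M" "a < \<delta>" using \<open>\<delta> > 0\<close> \<open>0 < M\<close> by (auto simp: a_def)
  have ga: "\<bar>g a - g 0\<bar> < e'" using \<delta>[of 0 a 1] a by (simp add: equipartition_variation_1[simplified])
  have near: "\<bar>integral {0..a} (\<lambda>u. g u * dirichlet_kernel R u) - g a * Si (R * a)\<bar> \<le> B * e'" for R
  proof -
    have "\<bar>integral {0..a} (\<lambda>u. g u * dirichlet_kernel R u) - (g a * Si (R * a) - g 0 * Si (R * 0))\<bar> \<le> B * e'"
      using a by (intro integral_by_parts_variation_bound cont continuous_on_dirichlet_kernel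
          DERIV_Si_scaled B less_imp_le[OF \<delta>]) auto
    moreover have "Si 0 = 0" using Si_neg[of 0] by simp
    ultimately show ?thesis by simp
  qed
  have "((\<lambda>R. g a * Si (R * a)) \<longlongrightarrow> g a * (pi / 2)) at_top"
    using \<open>0 < a\<close> by (intro tendsto_intros filterlim_compose[OF Si_at_top]
        filterlim_at_top_mult_tendsto_pos[OF tendsto_const] filterlim_ident)
  from tendstoD[OF this \<open>e' > 0\<close>]
  have ev1: "\<forall>\<^sub>F R in at_top. \<bar>g a * Si (R * a) - g a * (pi / 2)\<bar> < e'"
    unfolding dist_real_def .
  have ev2: "\<forall>\<^sub>F R in at_top. \<bar>integral {a..M} (\<lambda>u. g u * dirichlet_kernel R u)\<bar> < e'"
    using tendstoD[OF dirichlet_kernel_integral_tendsto_0[OF g a(1,2)] \<open>e' > 0\<close>] by (auto simp: dist_real_def)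
  show "\<forall>\<^sub>F R in at_top. dist (integral {0..M} (\<lambda>u. g u * dirichlet_kernel R u)) (pi / 2 * g 0) < e"
    using ev1 ev2
  proof eventually_elim
    case (elim R)
    have "integral {0..M} (\<lambda>u. g u * dirichlet_kernel R u)
      = integral {0..a} (\<lambda>u. g u * dirichlet_kernel R u) + integral {a..M} (\<lambda>u. g u * dirichlet_kernel R u)"
      using a by (intro Henstock_Kurzweil_Integration.integral_combine[symmetric] integrable_continuous_real
          continuous_on_mult cont continuous_on_dirichlet_kernel) auto
    moreover have "\<bar>g a * (pi / 2) - pi / 2 * g 0\<bar> < 2 * e'"
    proof -
      have "g a * (pi / 2) - pi / 2 * g 0 = pi / 2 * (g a - g 0)"
        by (simp add: algebra_simps)
      then have "\<bar>g a * (pi / 2) - pi / 2 * g 0\<bar> = pi / 2 * \<bar>g a - g 0\<bar>"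
        by (simp only: abs_mult) simp
      also have "\<dots> < 2 * e'"
        using ga pi_less_4 pi_gt_zero by (intro mult_strict_mono) auto
      finally show ?thesis .
    qed
    ultimately show ?case
      using near[of R] elim e'(2) by (simp add: dist_real_def algebra_simps)
  qed
qed

lemma integrable_mult_dirichlet_kernel:
  assumes "integrable lborel g"
  shows "integrable lborel (\<lambda>u. g u * dirichlet_kernel R u)"
proof (rule Bochner_Integration.integrable_bound)
  show "integrable lborel (\<lambda>u. \<bar>R\<bar> * g u)" using assms by simp
  show "AE u in lborel. norm (g u * dirichlet_kernel R u) \<le> norm (\<bar>R\<bar> * g u)"
    using abs_dirichlet_kernel_le[of R] by (auto simp: abs_mult mult.commute[of "\<bar>R\<bar>"] mult_left_mono)
qed (use assms in measurable)

text \<open>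
  Beyond \<open>M\<close> the kernel is at most \<open>1 / M\<close> for every \<open>R\<close>, so for integrable \<open>g\<close> the tail is small
  uniformly in \<open>R\<close> and the limits in \<open>R\<close> and \<open>M\<close> may be exchanged.
\<close>

lemma dirichlet_kernel_half_line_tendsto:
  assumes g: "locally_absolutely_continuous g" and int: "integrable lborel g"
  shows "((\<lambda>R. LINT u:{0..}|lborel. g u * dirichlet_kernel R u) \<longlongrightarrow> pi / 2 * g 0) at_top"
proof (rule tendstoI)
  fix e :: real assume "e > 0"
  define N where "N = (LINT u|lborel. \<bar>g u\<bar>)"
  have "N \<ge> 0" by (simp add: N_def)
  define M where "M = 2 * N / e + 1"
  have M: "M > 0" "N / M < e / 2"
    using \<open>N \<ge> 0\<close> \<open>e > 0\<close> by (auto simp: M_def field_simps add_pos_nonneg add_nonneg_pos)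
  have gD: "set_integrable lborel S (\<lambda>u. g u * dirichlet_kernel R u)" if "S \<in> sets borel" for R S
    using integrable_mult_dirichlet_kernel[OF int, of R] that
    unfolding set_integrable_def by (intro integrable_mult_indicator) auto
  have tail: "\<bar>LINT u:{M<..}|lborel. g u * dirichlet_kernel R u\<bar> \<le> N / M" for R
  proof -
    have "\<bar>LINT u:{M<..}|lborel. g u * dirichlet_kernel R u\<bar>
       \<le> (LINT u|lborel. norm (indicator {M<..} u *\<^sub>R (g u * dirichlet_kernel R u)))"
      unfolding set_lebesgue_integral_def real_norm_def[symmetric] by (rule integral_norm_bound)
    also have "\<dots> \<le> (LINT u|lborel. \<bar>g u\<bar> / M)"
    proof (rule integral_mono)
      show "norm (indicator {M<..} u *\<^sub>R (g u * dirichlet_kernel R u)) \<le> \<bar>g u\<bar> / M" for u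
        using abs_dirichlet_kernel_le_inverse[OF M(1), of u R] M(1)
          mult_left_mono[of "\<bar>dirichlet_kernel R u\<bar>" "1 / M" "\<bar>g u\<bar>"]
        by (auto simp: indicator_def abs_mult)
    qed (use gD[of "{M<..}" R] int in \<open>auto simp: set_integrable_def\<close>)
    finally show ?thesis by (simp add: N_def)
  qed
  have "\<forall>\<^sub>F R in at_top. \<bar>integral {0..M} (\<lambda>u. g u * dirichlet_kernel R u) - pi / 2 * g 0\<bar> < e / 2"
    using tendstoD[OF dirichlet_kernel_integral_tendsto[OF g M(1)], of "e / 2"] \<open>e > 0\<close>
    by (auto simp: dist_real_def)
  then show "\<forall>\<^sub>F R in at_top. dist (LINT u:{0..}|lborel. g u * dirichlet_kernel R u) (pi / 2 * g 0) < e"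
  proof eventually_elim
    case (elim R)
    have "{0..} = {0..M} \<union> {M<..}" using M(1) by auto
    then have "(LINT u:{0..}|lborel. g u * dirichlet_kernel R u)
      = (LINT u:{0..M}|lborel. g u * dirichlet_kernel R u) + (LINT u:{M<..}|lborel. g u * dirichlet_kernel R u)"
      using gD by (simp add: set_integral_Un ivl_disj_int)
    also have "(LINT u:{0..M}|lborel. g u * dirichlet_kernel R u)
      = integral {0..M} (\<lambda>u. g u * dirichlet_kernel R u)"
      using gD by (intro set_borel_integral_eq_integral) auto
    finally show ?case
      using tail[of R] elim M(2) unfolding dist_real_def by linarith
  qed
qed

section \<open>Fourier inversion\<close>

lemma truncated_exponential_integral:
  fixes u R :: real
  shows "(LBINT s=-R..R. exp (\<i> * complex_of_real (u * s))) = complex_of_real (2 * dirichlet_kernel R u)"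
proof (cases "u = 0")
  case True
  have "(LBINT s=-R..R. (1::complex)) = complex_of_real R - complex_of_real (- R)"
    by (rule interval_integral_FTC_finite)
       (auto intro!: derivative_eq_intros continuous_intros simp: has_vector_derivative_def scaleR_conv_of_real)
  with True show ?thesis by (simp add: dirichlet_kernel_def)
next
  case False
  have "(LBINT s=-R..R. exp (\<i> * complex_of_real (u * s)))
      = exp (\<i> * complex_of_real (u * R)) / (\<i> * complex_of_real u)
        - exp (\<i> * complex_of_real (u * - R)) / (\<i> * complex_of_real u)"
  proof (rule interval_integral_FTC_finite)
    show "((\<lambda>s. exp (\<i> * complex_of_real (u * s)) / (\<i> * complex_of_real u)) has_vector_derivative
        exp (\<i> * complex_of_real (u * s))) (at s within {min (- R) R..max (- R) R})" for s
    proof -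
      have "((\<lambda>z. exp (\<i> * (complex_of_real u * z)) / (\<i> * complex_of_real u)) has_field_derivative
          exp (\<i> * (complex_of_real u * of_real s))) (at (of_real s))"
        using False by (auto intro!: derivative_eq_intros simp: mult_ac)
      from has_vector_derivative_real_field[OF this] show ?thesis
        by (simp add: has_vector_derivative_at_within)
    qed
  qed (intro continuous_intros)
  also have "\<dots> = complex_of_real (2 * dirichlet_kernel R u)"
    using False by (auto simp: dirichlet_kernel_def complex_eq_iff Re_exp Im_exp Re_divide Im_divide
        power2_eq_square field_simps)
  finally show ?thesis .
qed

text \<open>
  Restricting \<open>s\<close> to \<open>[-R, R]\<close> makes the double integral absolutely convergent, so the order of
  integration can be exchanged; the integral over \<open>s\<close> is then explicit, and \<open>t = x + u\<close>.
\<close>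

lemma truncated_Fourier_inversion_eq_Dirichlet_integral:
  fixes f :: "real \<Rightarrow> real" and x R :: real
  assumes f: "integrable lborel f" and "R \<ge> 0"
  shows "(LINT s=-R..R|lebesgue. (exp (\<i> * complex_of_real (x * s)) *
            (LINT t|lebesgue. exp (- \<i> * complex_of_real (s * t)) * complex_of_real (f t))))
     = complex_of_real (2 * (LBINT u. f (x + u) * dirichlet_kernel R u))"
proof -
  have [measurable]: "f \<in> borel_measurable borel" using f by auto
  define \<Phi> where "\<Phi> s t = indicator {-R<..<R} s *\<^sub>R (exp (\<i> * complex_of_real ((x - t) * s)) * complex_of_real (f t))"
    for s t
  have \<Phi>_meas [measurable]: "(\<lambda>(s, t). \<Phi> s t) \<in> borel_measurable (lborel \<Otimes>\<^sub>M lborel)"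
    unfolding \<Phi>_def by measurable
  have norm_\<Phi>: "norm (\<Phi> s t) = indicator {-R<..<R} s * \<bar>f t\<bar>" for s t
    by (simp add: \<Phi>_def norm_mult indicator_def)
  have \<Phi>_int: "integrable (lborel \<Otimes>\<^sub>M lborel) (\<lambda>(s, t). \<Phi> s t)"
  proof (rule lborel_pair.Fubini_integrable[OF \<Phi>_meas])
    have "integrable lborel (\<lambda>s. indicator {-R<..<R} s * (LBINT t. \<bar>f t\<bar>))"
      using \<open>R \<ge> 0\<close> by (intro integrable_mult_left integrable_real_indicator) auto
    then show "integrable lborel (\<lambda>s. LBINT t. norm (case (s, t) of (s, t) \<Rightarrow> \<Phi> s t))"
      by (simp add: norm_\<Phi>)
    show "AE s in lborel. integrable lborel (\<lambda>t. case (s, t) of (s, t) \<Rightarrow> \<Phi> s t)"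
    proof (intro always_eventually allI)
      fix s
      have "integrable lborel (\<Phi> s)"
      proof (rule Bochner_Integration.integrable_bound[OF f])
        show "\<Phi> s \<in> borel_measurable lborel" unfolding \<Phi>_def [abs_def] by measurable
      qed (simp add: norm_\<Phi> indicator_def)
      then show "integrable lborel (\<lambda>t. case (s, t) of (s, t) \<Rightarrow> \<Phi> s t)" by simp
    qed
  qed
  have inner: "(LINT t|lebesgue. exp (- \<i> * complex_of_real (s * t)) * complex_of_real (f t))
      = (LBINT t. exp (- \<i> * complex_of_real (s * t)) * complex_of_real (f t))" for s
    by (rule integral_completion) measurable
  have "(LINT s=-R..R|lebesgue. (exp (\<i> * complex_of_real (x * s)) *
            (LINT t|lebesgue. exp (- \<i> * complex_of_real (s * t)) * complex_of_real (f t))))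
     = (LINT s|lebesgue. indicator {-R<..<R} s *\<^sub>R (exp (\<i> * complex_of_real (x * s)) *
            (LBINT t. exp (- \<i> * complex_of_real (s * t)) * complex_of_real (f t))))"
    using \<open>R \<ge> 0\<close> unfolding inner
    by (simp add: interval_lebesgue_integral_def set_lebesgue_integral_def)
  also have "\<dots> = (LBINT s. indicator {-R<..<R} s *\<^sub>R (exp (\<i> * complex_of_real (x * s)) *
            (LBINT t. exp (- \<i> * complex_of_real (s * t)) * complex_of_real (f t))))"
    by (rule integral_completion) measurable
  also have "\<dots> = (LBINT s. LBINT t. \<Phi> s t)"
  proof (rule Bochner_Integration.integral_cong[OF refl])
    fix s
    have "exp (\<i> * complex_of_real ((x - t) * s))
        = exp (\<i> * complex_of_real (x * s)) * exp (- \<i> * complex_of_real (s * t))" for t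
      unfolding exp_add[symmetric] by (rule arg_cong[where f = exp]) (simp add: algebra_simps)
    then have "\<Phi> s t = indicator {-R<..<R} s *\<^sub>R (exp (\<i> * complex_of_real (x * s)) *
        (exp (- \<i> * complex_of_real (s * t)) * complex_of_real (f t)))" for t
      unfolding \<Phi>_def by (simp only: mult.assoc)
    then show "indicator {-R<..<R} s *\<^sub>R (exp (\<i> * complex_of_real (x * s)) *
        (LBINT t. exp (- \<i> * complex_of_real (s * t)) * complex_of_real (f t))) = (LBINT t. \<Phi> s t)"
      by (simp only: integral_scaleR_right integral_mult_right_zero)
  qed
  also have "\<dots> = (LBINT t. LBINT s. \<Phi> s t)"
    by (rule lborel_pair.Fubini_integral[OF \<Phi>_int, symmetric])
  also have "\<dots> = (LBINT t. complex_of_real (2 * (f t * dirichlet_kernel R (x - t))))"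
  proof (rule Bochner_Integration.integral_cong[OF refl])
    fix t
    have "(LBINT s. \<Phi> s t)
        = (LBINT s=-R..R. exp (\<i> * complex_of_real ((x - t) * s))) * complex_of_real (f t)"
      using \<open>R \<ge> 0\<close>
      by (simp add: \<Phi>_def interval_lebesgue_integral_def set_lebesgue_integral_def
          flip: integral_mult_left_zero)
    then show "(LBINT s. \<Phi> s t) = complex_of_real (2 * (f t * dirichlet_kernel R (x - t)))"
      unfolding truncated_exponential_integral by simp
  qed
  also have "\<dots> = complex_of_real (2 * (LBINT t. f t * dirichlet_kernel R (x - t)))"
    unfolding integral_complex_of_real by simp
  also have "(LBINT t. f t * dirichlet_kernel R (x - t)) = (LBINT u. f (x + u) * dirichlet_kernel R u)"
    using lborel_integral_real_affine[of 1 "\<lambda>t. f t * dirichlet_kernel R (x - t)" x] by simp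
  finally show ?thesis .
qed

lemma integral_eq_half_line_integrals:
  fixes h :: "real \<Rightarrow> real"
  assumes h: "integrable lborel h"
  shows "(LBINT u. h u) = (LBINT u:{0..}. h u) + (LBINT u:{0..}. h (- u))"
proof -
  have [measurable]: "h \<in> borel_measurable borel" using h by auto
  have "set_integrable lborel S h" if "S \<in> sets borel" for S
    using h that unfolding set_integrable_def by (intro integrable_mult_indicator) auto
  then have "(LBINT u:{0..} \<union> {..<0}. h u) = (LBINT u:{0..}. h u) + (LBINT u:{..<0}. h u)"
    by (intro set_integral_Un) auto
  moreover have "{0..} \<union> {..<0} = (UNIV :: real set)" by auto
  moreover have "(LBINT u:{..<0}. h u) = (LBINT u. indicator {..<0} (- u) *\<^sub>R h (- u))"
    using lborel_integral_real_affine[of "-1" "\<lambda>u. indicator {..<0} u *\<^sub>R h u" 0]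
    by (simp add: set_lebesgue_integral_def)
  moreover have "\<dots> = (LBINT u:{0..}. h (- u))"
    unfolding set_lebesgue_integral_def
    using AE_lborel_singleton[of 0] by (intro integral_cong_AE) (auto simp: indicator_def)
  ultimately show ?thesis by (simp add: set_lebesgue_integral_def)
qed

theorem theorem2p2:
  fixes f :: "real \<Rightarrow> real" and x :: real
  assumes "locally_absolutely_continuous f"
    and "integrable lebesgue f"
    and "integrable lebesgue (deriv f)"
  shows "((\<lambda>R::real. 1 / (2 * complex_of_real pi) *
            (LINT s=-R..R|lebesgue. (exp (\<i> * complex_of_real (x * s)) *
              (LINT t|lebesgue. exp (- \<i> * complex_of_real (s * t)) * complex_of_real (f t)))))
          \<longlongrightarrow> complex_of_real (f x)) at_top"
proof -
  have "f \<in> borel_measurable borel"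
    by (intro borel_measurable_continuous_onI locally_absolutely_continuous_imp_continuous assms(1))
  then have f: "integrable lborel f"
    using assms(2) by (simp add: integrable_completion)
  have fp: "integrable lborel (\<lambda>u. f (x + u))" and fm: "integrable lborel (\<lambda>u. f (x - u))"
    using lborel_integrable_real_affine[OF f, of 1 x] lborel_integrable_real_affine[OF f, of "-1" x] by simp_all
  have acm: "locally_absolutely_continuous (\<lambda>u. f (x - u))"
    using assms(1) by (rule locally_absolutely_continuous_reflect)
  have acp: "locally_absolutely_continuous (\<lambda>u. f (x + u))"
    using locally_absolutely_continuous_reflect[OF acm, of 0] by simp
  have "((\<lambda>R. (LBINT u:{0..}. f (x + u) * dirichlet_kernel R u) + (LBINT u:{0..}. f (x - u) * dirichlet_kernel R u))
      \<longlongrightarrow> pi / 2 * f (x + 0) + pi / 2 * f (x - 0)) at_top"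
    by (intro tendsto_add dirichlet_kernel_half_line_tendsto acp acm fp fm)
  also have "(\<lambda>R. (LBINT u:{0..}. f (x + u) * dirichlet_kernel R u) + (LBINT u:{0..}. f (x - u) * dirichlet_kernel R u))
     = (\<lambda>R. LBINT u. f (x + u) * dirichlet_kernel R u)"
    using integral_eq_half_line_integrals[OF integrable_mult_dirichlet_kernel[OF fp]] by simp
  finally have "((\<lambda>R. 1 / (2 * complex_of_real pi) * complex_of_real (2 * (LBINT u. f (x + u) * dirichlet_kernel R u)))
      \<longlongrightarrow> 1 / (2 * complex_of_real pi) * complex_of_real (2 * (pi * f x))) at_top"
    by (intro tendsto_intros) simp
  then have "((\<lambda>R. 1 / (2 * complex_of_real pi) * complex_of_real (2 * (LBINT u. f (x + u) * dirichlet_kernel R u)))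
      \<longlongrightarrow> complex_of_real (f x)) at_top"
    by simp
  moreover have "\<forall>\<^sub>F R::real in at_top.
      1 / (2 * complex_of_real pi) * complex_of_real (2 * (LBINT u. f (x + u) * dirichlet_kernel R u))
      = 1 / (2 * complex_of_real pi) *
            (LINT s=-R..R|lebesgue. (exp (\<i> * complex_of_real (x * s)) *
              (LINT t|lebesgue. exp (- \<i> * complex_of_real (s * t)) * complex_of_real (f t))))"
    using eventually_ge_at_top[of 0]
  proof eventually_elim
    case (elim R)
    from truncated_Fourier_inversion_eq_Dirichlet_integral[OF f elim, of x] show ?case by simp
  qed
  ultimately show ?thesis
    unfolding uminus_ereal.simps by (rule Lim_transform_eventually)
qed

end
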